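(* For every positive integer $n$, $$pod_5(n)\equiv (-1)^n\sigma_1(2n+1)\pmod 5,$$ and $$pod_7(n)\equiv (-1)^{n+1}\,\frac{1}{8}\,\sigma_{2,\chi}(4n+3)\pmod 7.$$
   Context: For a positive integer $\ell$, $pod_\ell(n)$ denotes the number of partitions of $n$ in which no part is divisible by $\ell$, the odd parts are distinct, and the even parts are unrestricted; equivalently $\sum_{n\ge0}pod_\ell(n)q^n=\psi(-q^\ell)/\psi(-q)$ with $\psi(q)=\sum_{n\ge0}q^{n(n+1)/2}$. For a positive integer $m$, $\sigma_1(m)=\sum_{d\mid m}d$, and $\sigma_{2,\chi}(m)=\sum_{d\mid m}\chi(d)d^2$, where $\chi$ is the non-principal Dirichlet character modulo $4$ ($\chi(1)=1$, $\chi(3)=-1$, $\chi(d)=0$ for even $d$). The factor $\frac18$ is understood as a rational number with denominator coprime to $7$ (equivalently, the inverse of $8$ modulo $7$). *)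

theory Defs
  imports Complex_Main "HOL-Library.Multiset" "HOL-Number_Theory.Cong"
begin

text \<open>A partition of \<open>n\<close> is a multiset of positive integers with sum \<open>n\<close>.\<close>

definition pod_partitions :: "nat \<Rightarrow> nat \<Rightarrow> nat multiset set" where
  "pod_partitions l n =
     {P. sum_mset P = n \<and> (\<forall>k. k \<in># P \<longrightarrow> k > 0 \<and> \<not> l dvd k) \<and>
         (\<forall>k. odd k \<longrightarrow> count P k \<le> 1)}"

definition pod :: "nat \<Rightarrow> nat \<Rightarrow> nat" where
  "pod l n = card (pod_partitions l n)"

lemma finite_pod_partitions: "finite (pod_partitions l n)"
proof (rule finite_subset)
  show "pod_partitions l n \<subseteq> mset ` {xs. set xs \<subseteq> {..n} \<and> length xs \<le> n}"
  proof
    fix P assume P: "P \<in> pod_partitions l n"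
    obtain xs where xs: "mset xs = P" using ex_mset by blast
    have sum: "sum_list xs = n"
      using P xs by (auto simp: pod_partitions_def simp flip: sum_mset_sum_list)
    have "set xs \<subseteq> {..n}" using sum member_le_sum_list by fastforce
    moreover have "length xs \<le> n"
    proof -
      have "\<forall>x\<in>set xs. x \<ge> 1"
        using P xs by (auto simp: pod_partitions_def Suc_le_eq)
      then have "length xs \<le> sum_list xs"
        by (induction xs) auto
      then show ?thesis using sum by simp
    qed
    ultimately show "P \<in> mset ` {xs. set xs \<subseteq> {..n} \<and> length xs \<le> n}"
      using xs by blast
  qed
  show "finite (mset ` {xs. set xs \<subseteq> {..n} \<and> length xs \<le> n})"
    by (intro finite_imageI finite_lists_length_le) simp
qed

text \<open>The divisor sums below are meant for \<open>m > 0\<close> only.\<close>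

definition sigma1 :: "nat \<Rightarrow> nat" where
  "sigma1 m = (\<Sum>d | d dvd m. d)"

definition chi4 :: "nat \<Rightarrow> int" where
  "chi4 d = (if d mod 4 = 1 then 1 else if d mod 4 = 3 then -1 else 0)"

definition sigma2_chi :: "nat \<Rightarrow> int" where
  "sigma2_chi m = (\<Sum>d | d dvd m. chi4 d * (int d)\<^sup>2)"

text \<open>
  Congruence modulo \<open>m\<close> of rationals: the difference is \<open>m\<close> times a fraction
  whose denominator is coprime to \<open>m\<close>.
\<close>

definition rat_cong :: "rat \<Rightarrow> rat \<Rightarrow> int \<Rightarrow> bool" where
  "rat_cong x y m \<longleftrightarrow>
     (\<exists>a b :: int. b \<noteq> 0 \<and> coprime b m \<and> x - y = of_int m * (of_int a / of_int b))"

end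

theory Submission
  imports Defs "HOL-Computational_Algebra.Formal_Power_Series"
begin

text \<open>
  With \<open>q\<close> replaced by \<open>-q\<close>, the generating function of \<open>pod l\<close> is \<open>\<psi>(q ^ l) / \<psi>(q)\<close>, where
  \<open>\<psi>\<close> is Gauss' product, expanded by means of Shanks' finite identity. For a prime \<open>l\<close> it is
  congruent to \<open>\<psi> ^ (l - 1)\<close>, so the theorem reduces to the number of representations by four
  and by six triangular numbers. The coefficients of \<open>\<psi> ^ k\<close> are determined by a linear
  recurrence; that the divisor sums satisfy it amounts to the vanishing of a polynomial sum
  over all \<open>x\<^sup>2 + 4 * d * e = M\<close> (for \<open>k = 4\<close>) and a character sum over all
  \<open>x\<^sup>2 + 2 * d * e = M\<close> (for \<open>k = 6\<close>). These sums cancel under involutions in the style of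
  Liouville and Zagier: the solutions are cut into regions by linear inequalities, the
  regions are matched by \<open>(x, d, e) \<mapsto> (-x, e, d)\<close>, and the summand, after adding a term that is
  odd in \<open>x\<close>, changes sign under an involution of each region.
\<close>

unbundle fps_syntax

section \<open>Sums over representations by \<open>x\<^sup>2 + c * d * e\<close>\<close>

text \<open>Reindexing along \<open>\<tau>\<close> turns the sum into its own negative. Fixed points
  are allowed, since \<open>f\<close> vanishes there.\<close>

lemma sum_involution_eq_0:
  fixes f :: "'a \<Rightarrow> int"
  assumes "\<And>a. a \<in> A \<Longrightarrow> \<tau> a \<in> A" "\<And>a. a \<in> A \<Longrightarrow> \<tau> (\<tau> a) = a"
    and "\<And>a. a \<in> A \<Longrightarrow> f (\<tau> a) = - f a"
  shows "sum f A = 0"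
proof -
  have "sum f A = sum (\<lambda>a. f (\<tau> a)) A"
    by (rule sum.reindex_bij_witness[of A \<tau> \<tau>]) (use assms in auto)
  also have "\<dots> = - sum f A"
    using assms(3) by (simp add: sum_negf)
  finally show ?thesis by simp
qed

definition qreps :: "int \<Rightarrow> int \<Rightarrow> (int \<times> int \<times> int) set" where
  "qreps c M = {(x, d, e). odd x \<and> d > 0 \<and> e > 0 \<and> x\<^sup>2 + c * d * e = M}"

lemma finite_qreps:
  assumes "c > 0"
  shows "finite (qreps c M)"
proof (rule finite_subset)
  show "qreps c M \<subseteq> {-M..M} \<times> {0..M} \<times> {0..M}"
  proof (clarsimp simp: qreps_def, intro conjI)
    fix x d e :: int assume *: "0 < d" "0 < e" "M = x\<^sup>2 + c * d * e"
    have "d * 1 \<le> (c * d) * e" "e * 1 \<le> e * (c * d)"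
      using assms * by (auto intro!: mult_mono simp: int_one_le_iff_zero_less simp del: mult_1_right)
    moreover have "\<bar>x\<bar> \<le> x\<^sup>2"
      using abs_le_square_iff[of 1 x] self_le_power[of "\<bar>x\<bar>" 2] by (cases "x = 0") auto
    moreover have "0 \<le> x\<^sup>2" "0 < c * d * e" using assms * by auto
    ultimately show "- (x\<^sup>2) - c * d * e \<le> x" "x \<le> x\<^sup>2 + c * d * e"
      "d \<le> x\<^sup>2 + c * d * e" "e \<le> x\<^sup>2 + c * d * e"
      by (auto simp: mult.commute)
  qed
qed auto

lemma odd_square_mod_8: "odd (x::int) \<Longrightarrow> x\<^sup>2 mod 8 = 1"
proof -
  assume "odd x"
  then obtain k where k: "x = 2 * k + 1" by (elim oddE)
  have "even (k * (k + 1))" by simp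
  then obtain m where m: "k * (k + 1) = 2 * m" by (elim evenE)
  have "x\<^sup>2 = 4 * (k * (k + 1)) + 1" unfolding k by (simp add: power2_eq_square algebra_simps)
  also have "\<dots> = 8 * m + 1" using m by simp
  finally show ?thesis by simp
qed

text \<open>On \<open>qreps 4 M\<close> the factor \<open>M - 5 * x\<^sup>2\<close> is four times
  \<open>d * e - x\<^sup>2\<close>. Swapping \<open>d\<close> and \<open>e\<close> symmetrises the
  weight to \<open>G\<close>, and \<open>E\<close> subtracts from it a term odd in \<open>x\<close>.
  Since \<open>E\<close> factors as (d + e)(d + x)(e - x), the involution of \<open>A\<close> swaps
  the outer factors and negates the middle one, while the matching of \<open>A\<close> with
  \<open>B\<close> swaps the last two.\<close>

lemma sum_qreps_4_eq_0:
  assumes M: "M mod 8 = 5"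
  shows "(\<Sum>(x, d, e)\<in>qreps 4 M. (M - 5 * x\<^sup>2) * d) = 0"
proof -
  let ?S = "qreps 4 M"
  have fin: "finite ?S" by (simp add: finite_qreps)
  have odd_de: "odd d \<and> odd e" if "(x, d, e) \<in> ?S" for x d e
  proof -
    have "x\<^sup>2 mod 8 = 1" "x\<^sup>2 + 4 * (d * e) = M"
      using that odd_square_mod_8 by (auto simp: qreps_def)
    moreover have "odd w" if "a mod 8 = 1" "a + 4 * w = M" for a w
      using that M by presburger
    ultimately have "odd (d * e)" by blast
    thus ?thesis by simp
  qed
  define A where "A = {(x, d, e) \<in> ?S. e > x + d}"
  define B where "B = {(x, d, e) \<in> ?S. e < x + d}"
  have S: "?S = A \<union> B" "A \<inter> B = {}"
  proof -
    \<comment> \<open>For odd \<open>x\<close>, \<open>d\<close>, \<open>e\<close> the sum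
      \<open>x + d\<close> is even, so no solution lies on the boundary.\<close>
    have "e \<noteq> x + d" if "(x, d, e) \<in> ?S" for x d e
      using odd_de[OF that] that by (auto simp: qreps_def)
    thus "?S = A \<union> B" "A \<inter> B = {}" by (auto simp: A_def B_def neq_iff)
  qed
  define G :: "int \<times> int \<times> int \<Rightarrow> int" where "G = (\<lambda>(x, d, e). (d * e - x\<^sup>2) * (d + e))"
  define E :: "int \<times> int \<times> int \<Rightarrow> int" where "E = (\<lambda>(x, d, e). (d * e - x\<^sup>2) * (d + e) - x * (d\<^sup>2 - e\<^sup>2))"
  have "sum E A = 0"
  \<comment> \<open>The inequality of \<open>A\<close> says that the new third entry is positive;
    conversely \<open>e > 0\<close> is that inequality at the image.\<close>
  proof (rule sum_involution_eq_0[where \<tau> = "\<lambda>(x, d, e). (- x - 2 * d, d, e - x - d)"], goal_cases)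
    case (1 a)
    then show ?case by (auto simp: A_def qreps_def algebra_simps power2_eq_square)
  next
    case (3 a)
    then show ?case by (cases a) (simp add: E_def algebra_simps power2_eq_square)
  qed auto
  moreover have "sum E B = sum E A"
    by (rule sum.reindex_bij_witness[of _ "\<lambda>(x, d, e). (- x, e, d)" "\<lambda>(x, d, e). (- x, e, d)"])
       (auto simp: A_def B_def qreps_def E_def algebra_simps)
  ultimately have "sum E ?S = 0"
    using S fin by (simp add: sum.union_disjoint)
  moreover have "(\<Sum>(x, d, e)\<in>?S. x * (d\<^sup>2 - e\<^sup>2)) = 0"
    by (rule sum_involution_eq_0[where \<tau> = "\<lambda>(x, d, e). (- x, d, e)"]) (auto simp: qreps_def algebra_simps)
  moreover have "sum E ?S = sum G ?S - (\<Sum>(x, d, e)\<in>?S. x * (d\<^sup>2 - e\<^sup>2))"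
    unfolding sum_subtractf[symmetric] by (intro sum.cong) (auto simp: E_def G_def)
  ultimately have "sum G ?S = 0" by simp
  also have "sum G ?S = (\<Sum>(x, d, e)\<in>?S. (d * e - x\<^sup>2) * d) + (\<Sum>(x, d, e)\<in>?S. (d * e - x\<^sup>2) * e)"
    unfolding sum.distrib[symmetric] by (intro sum.cong) (auto simp: G_def algebra_simps)
  also have "(\<Sum>(x, d, e)\<in>?S. (d * e - x\<^sup>2) * e) = (\<Sum>(x, d, e)\<in>?S. (d * e - x\<^sup>2) * d)"
    by (rule sum.reindex_bij_witness[of _ "\<lambda>(x, d, e). (x, e, d)" "\<lambda>(x, d, e). (x, e, d)"])
       (auto simp: qreps_def algebra_simps)
  finally have "(\<Sum>(x, d, e)\<in>?S. (d * e - x\<^sup>2) * d) = 0" by simp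
  moreover have "(\<Sum>(x, d, e)\<in>?S. (M - 5 * x\<^sup>2) * d) = (\<Sum>(x, d, e)\<in>?S. 4 * ((d * e - x\<^sup>2) * d))"
    by (intro sum.cong) (auto simp: qreps_def algebra_simps)
  ultimately show ?thesis
    by (simp add: sum_distrib_left[symmetric] case_prod_unfold)
qed

definition chi4_int :: "int \<Rightarrow> int" where
  "chi4_int d = (if d mod 4 = 1 then 1 else if d mod 4 = 3 then -1 else 0)"

text \<open>On \<open>qreps 2 M\<close> the factor \<open>M - 7 * x\<^sup>2\<close> is twice
  \<open>d * e - 3 * x\<^sup>2\<close>, and \<open>d * e\<close> is 3 modulo 4, so swapping
  \<open>d\<close> and \<open>e\<close> negates the character and antisymmetrises
  \<open>d\<^sup>2\<close>. With the odd term \<open>P\<close> added, \<open>E0\<close> factors as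
  (d + e)(d + x)(e - x)(d - e + 2x), and each map below permutes these factors up to sign.\<close>

lemma sum_qreps_2_eq_0:
  assumes M: "M mod 8 = 7"
  shows "(\<Sum>(x, d, e)\<in>qreps 2 M. (M - 7 * x\<^sup>2) * (chi4_int d * d\<^sup>2)) = 0"
proof -
  let ?S = "qreps 2 M"
  have fin: "finite ?S" by (simp add: finite_qreps)
  have odd_de: "odd d \<and> odd e \<and> (d * e) mod 4 = 3" if "(x, d, e) \<in> ?S" for x d e
  proof -
    have "x\<^sup>2 mod 8 = 1" "x\<^sup>2 + 2 * (d * e) = M"
      using that odd_square_mod_8 by (auto simp: qreps_def)
    moreover have "w mod 4 = 3 \<and> odd w" if "a mod 8 = 1" "a + 2 * w = M" for a w
      using that M by presburger
    ultimately have *: "(d * e) mod 4 = 3" "odd (d * e)" by blast+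
    thus ?thesis using * by simp
  qed
  have mods: "e mod 4 = 1 \<and> d mod 4 = 3 \<or> e mod 4 = 3 \<and> d mod 4 = 1" if "(x, d, e) \<in> ?S" for x d e
  proof -
    have d: "d mod 4 = 1 \<or> d mod 4 = 3" using odd_de[OF that] by presburger
    have e: "e mod 4 = 1 \<or> e mod 4 = 3" using odd_de[OF that] by presburger
    have "((d mod 4) * (e mod 4)) mod 4 = 3" using odd_de[OF that] by (simp add: mod_mult_eq)
    thus ?thesis using d e by auto
  qed
  have chi_swap: "chi4_int e = - chi4_int d" if "(x, d, e) \<in> ?S" for x d e
    using mods[OF that] by (auto simp: chi4_int_def)
  define A where "A = {(x, d, e) \<in> ?S. e > 2 * x + 2 * d}"
  define B where "B = {(x, d, e) \<in> ?S. d > 2 * e - 2 * x}"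
  define C where "C = {(x, d, e) \<in> ?S. e < 2 * x + 2 * d \<and> d < 2 * e - 2 * x}"
  have S: "?S = A \<union> B \<union> C" "A \<inter> B = {}" "(A \<union> B) \<inter> C = {}"
  proof -
    \<comment> \<open>Oddness of \<open>d\<close> and \<open>e\<close> excludes the boundaries;
      \<open>A\<close> and \<open>B\<close> are disjoint because their inequalities add up to d + e
      > 2d + 2e.\<close>
    have "e \<noteq> 2 * x + 2 * d \<and> d \<noteq> 2 * e - 2 * x" if "(x, d, e) \<in> ?S" for x d e
      using odd_de[OF that] by auto
    thus "?S = A \<union> B \<union> C" "A \<inter> B = {}" "(A \<union> B) \<inter> C = {}"
      by (fastforce simp: A_def B_def C_def qreps_def)+
  qed
  define P :: "int \<Rightarrow> int \<Rightarrow> int \<Rightarrow> int" where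
    "P = (\<lambda>x d e. x * (d + e) * (4 * d * e - d\<^sup>2 - e\<^sup>2 - 2 * x\<^sup>2))"
  define E0 where "E0 = (\<lambda>x d e. (d * e - 3 * x\<^sup>2) * (d\<^sup>2 - e\<^sup>2) + P x d e)"
  define E where "E = (\<lambda>(x, d, e). chi4_int d * E0 x d e)"
  have "sum E A = 0"
  proof (rule sum_involution_eq_0[where \<tau> = "\<lambda>(x, d, e). (- x - 2 * d, d, e - 2 * x - 2 * d)"], goal_cases)
    case (1 a)
    then show ?case by (auto simp: A_def qreps_def algebra_simps power2_eq_square)
  next
    case (3 a)
    have "E0 (- x - 2 * d) d (e - 2 * x - 2 * d) = - E0 x d e" for x d e
      unfolding E0_def P_def by algebra
    then show ?case by (cases a) (simp add: E_def)
  qed auto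
  moreover have "sum E B = sum E A"
  proof (rule sum.reindex_bij_witness[of _ "\<lambda>(x, d, e). (- x, e, d)" "\<lambda>(x, d, e). (- x, e, d)"], goal_cases)
    case (5 a)
    have "E0 (- x) e d = - E0 x d e" for x d e
      unfolding E0_def P_def by algebra
    then show ?case using 5 chi_swap by (auto simp: B_def E_def)
  qed (auto simp: A_def B_def qreps_def algebra_simps)
  moreover have "sum E C = 0"
  \<comment> \<open>The two inequalities of \<open>C\<close> say that the new second and third
    entries are positive. The map fixes d + e, swaps d + x with e - x and negates d - e +
    2x.\<close>
  proof (rule sum_involution_eq_0[where \<tau> = "\<lambda>(x, d, e). (2 * e - 2 * d - 3 * x, 2 * d + 2 * x - e, 2 * e - 2 * x - d)"], goal_cases)
    case (1 a)
    then show ?case by (auto simp: C_def qreps_def algebra_simps power2_eq_square)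
  next
    case (3 a)
    have *: "E0 (2 * e - 2 * d - 3 * x) (2 * d + 2 * x - e) (2 * e - 2 * x - d) = - E0 x d e" for x d e
      unfolding E0_def P_def by algebra
    obtain x d e where a: "a = (x, d, e)" by (cases a)
    have "(x, d, e) \<in> ?S" "odd x" using 3 a by (auto simp: C_def qreps_def)
    \<comment> \<open>Since \<open>d + x\<close> is even, the new entry is -e modulo 4, and this is
      \<open>d\<close> modulo 4 by \<open>mods\<close>.\<close>
    from mods[OF this(1)] this(2) have "(2 * d + 2 * x - e) mod 4 = d mod 4"
      by presburger
    hence "chi4_int (2 * d + 2 * x - e) = chi4_int d" by (simp add: chi4_int_def)
    then show ?case using a * by (simp add: E_def)
  qed (auto simp: algebra_simps)
  ultimately have "sum E ?S = 0"
    using S fin by (simp add: sum.union_disjoint)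
  moreover have "(\<Sum>(x, d, e)\<in>?S. chi4_int d * P x d e) = 0"
    by (rule sum_involution_eq_0[where \<tau> = "\<lambda>(x, d, e). (- x, d, e)"])
       (auto simp: qreps_def P_def)
  moreover have "sum E ?S = (\<Sum>(x, d, e)\<in>?S. chi4_int d * ((d * e - 3 * x\<^sup>2) * d\<^sup>2))
      - (\<Sum>(x, d, e)\<in>?S. chi4_int d * ((d * e - 3 * x\<^sup>2) * e\<^sup>2)) + (\<Sum>(x, d, e)\<in>?S. chi4_int d * P x d e)"
    unfolding sum_subtractf[symmetric] sum.distrib[symmetric]
    by (intro sum.cong) (auto simp: E_def E0_def algebra_simps)
  moreover have "(\<Sum>(x, d, e)\<in>?S. chi4_int d * ((d * e - 3 * x\<^sup>2) * e\<^sup>2)) =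
       (\<Sum>(x, d, e)\<in>?S. - (chi4_int d * ((d * e - 3 * x\<^sup>2) * d\<^sup>2)))"
    by (rule sum.reindex_bij_witness[of _ "\<lambda>(x, d, e). (x, e, d)" "\<lambda>(x, d, e). (x, e, d)"])
       (auto simp: qreps_def mult_ac dest!: chi_swap, auto simp: qreps_def algebra_simps chi_swap)
  ultimately have "(\<Sum>(x, d, e)\<in>?S. chi4_int d * ((d * e - 3 * x\<^sup>2) * d\<^sup>2)) = 0"
    by (simp add: case_prod_unfold sum_negf)
  moreover have "(\<Sum>(x, d, e)\<in>?S. (M - 7 * x\<^sup>2) * (chi4_int d * d\<^sup>2))
     = (\<Sum>(x, d, e)\<in>?S. 2 * (chi4_int d * ((d * e - 3 * x\<^sup>2) * d\<^sup>2)))"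
    by (intro sum.cong) (auto simp: qreps_def algebra_simps)
  ultimately show ?thesis
    by (simp add: sum_distrib_left[symmetric] case_prod_unfold)
qed

section \<open>Powers of \<open>\<psi>\<close>\<close>

definition tri :: "nat \<Rightarrow> nat" where
  "tri k = k * (k + 1) div 2"

lemma two_tri: "2 * tri k = k * (k + 1)"
  by (simp add: tri_def)

lemma tri_0 [simp]: "tri 0 = 0"
  by (simp add: tri_def)

lemma tri_Suc: "tri (Suc k) = tri k + Suc k"
  by (simp add: tri_def)

lemma tri_ge: "k \<le> tri k"
  by (induction k) (auto simp: tri_Suc)

lemma strict_mono_tri: "strict_mono tri"
  by (rule strict_mono_Suc_iff[THEN iffD2]) (auto simp: tri_Suc)

lemma eight_tri: "8 * int (tri k) + 1 = (2 * int k + 1)\<^sup>2"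
proof -
  have "2 * int (tri k) = int k * (int k + 1)"
    using arg_cong[OF two_tri[of k], of int] by (simp add: algebra_simps)
  thus ?thesis by (simp add: power2_eq_square algebra_simps)
qed

definition tri_ind :: "nat \<Rightarrow> int" where
  "tri_ind j = (if j \<in> range tri then 1 else 0)"

lemma sqrt_set_eq:
  "{x::int. x\<^sup>2 = 8 * int (tri k) + 1} = {2 * int k + 1, - (2 * int k + 1)}"
  unfolding eight_tri by (auto simp: power2_eq_iff)

text \<open>A root is odd, so its absolute value is 2k + 1 with \<open>j = tri k\<close>; the two
  signs give distinct roots.\<close>

lemma card_sqrt_set: "int (card {x::int. x\<^sup>2 = 8 * int j + 1}) = 2 * tri_ind j"
proof (cases "j \<in> range tri")
  case True
  then obtain k where "j = tri k" by auto
  moreover have "2 * int k + 1 \<noteq> - (2 * int k + 1)" by presburger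
  ultimately show ?thesis using True by (simp add: sqrt_set_eq tri_ind_def)
next
  case False
  have "x\<^sup>2 \<noteq> 8 * int j + 1" for x :: int
  proof
    assume x: "x\<^sup>2 = 8 * int j + 1"
    hence "odd (x\<^sup>2)" by simp
    hence "odd \<bar>x\<bar>" by simp
    then obtain k where k: "\<bar>x\<bar> = 2 * k + 1" by (elim oddE)
    hence "8 * int (tri (nat k)) + 1 = \<bar>x\<bar>\<^sup>2" by (simp add: eight_tri)
    with x have "j = tri (nat k)" by simp
    thus False using False by blast
  qed
  thus ?thesis using False by (simp add: tri_ind_def)
qed

lemma finite_sqrt_set: "finite {x::int. x\<^sup>2 = 8 * int j + 1}"
proof (rule finite_subset)
  show "{x::int. x\<^sup>2 = 8 * int j + 1} \<subseteq> {-(8 * int j + 1)..8 * int j + 1}"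
  proof
    fix x :: int assume "x \<in> {x. x\<^sup>2 = 8 * int j + 1}"
    hence x: "x\<^sup>2 = 8 * int j + 1" by simp
    have "\<bar>x\<bar> \<le> \<bar>x\<bar>\<^sup>2" using self_le_power[of "\<bar>x\<bar>" 2] by (cases "x = 0") auto
    thus "x \<in> {-(8 * int j + 1)..8 * int j + 1}" using x by auto
  qed
qed auto

text \<open>Turns sums over representations into convolutions. The odd square is 8j + 1 for a
  triangular \<open>j\<close>, with two choices of \<open>x\<close>; what remains is
  \<open>c * w (n - j)\<close>, so \<open>d\<close> runs through the divisors of
  \<open>w (n - j)\<close> and \<open>e\<close> is the cofactor.\<close>

lemma sum_qreps_eq:
  fixes h g :: "int \<Rightarrow> int" and w :: "nat \<Rightarrow> nat"
  assumes c: "c > 0" and r: "0 < r" "r < 8" and w: "\<And>k. c * int (w k) = 8 * int k + r"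
  shows "(\<Sum>(x, d, e)\<in>qreps c (8 * int n + 1 + r). h (x\<^sup>2) * g d) =
         2 * (\<Sum>j\<le>n. tri_ind j * h (8 * int j + 1) * (\<Sum>d | d dvd w (n - j). g (int d)))"
proof -
  let ?X = "\<lambda>j. {x::int. x\<^sup>2 = 8 * int j + 1}"
  let ?T = "SIGMA j:{..n}. ?X j \<times> {d. d dvd w (n - j)}"
  have w_pos: "w k > 0" for k
    using w[of k] c r by (intro Nat.gr0I) auto
  have fin: "finite {d. d dvd w k}" for k
    using w_pos by simp
  have rep: "\<exists>j\<le>n. \<exists>d' e'. d = int d' \<and> e = int e' \<and> d' > 0 \<and> x\<^sup>2 = 8 * int j + 1 \<and> w (n - j) = d' * e'"
    if "(x, d, e) \<in> qreps c (8 * int n + 1 + r)" for x d e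
  proof -
    have *: "odd x" "d > 0" "e > 0" "x\<^sup>2 + c * (d * e) = 8 * int n + 1 + r"
      using that by (auto simp: qreps_def mult.assoc)
    define j where "j = nat (x\<^sup>2 div 8)"
    have "x\<^sup>2 mod 8 = 1" using * odd_square_mod_8 by simp
    hence j: "x\<^sup>2 = 8 * int j + 1"
      using mult_div_mod_eq[of 8 "x\<^sup>2"] by (simp add: j_def pos_imp_zdiv_nonneg_iff)
    have "c * (d * e) > 0" using c * by simp
    \<comment> \<open>Positivity of \<open>c * (d * e)\<close> gives 8j < 8n + r, and r < 8.\<close>
    hence jn: "j \<le> n" using * j r by linarith
    have "c * (d * e) = c * int (w (n - j))"
      using *(4) j jn by (simp add: w of_nat_diff)
    hence "int (w (n - j)) = d * e" using c by simp
    hence "int (w (n - j)) = int (nat d * nat e)" using * by simp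
    hence "w (n - j) = nat d * nat e" by (simp only: of_nat_eq_iff)
    thus ?thesis using * j jn by (intro exI[of _ j] conjI exI[of _ "nat d"] exI[of _ "nat e"]) auto
  qed
  have "(\<Sum>(x, d, e)\<in>qreps c (8 * int n + 1 + r). h (x\<^sup>2) * g d) =
        (\<Sum>(j, x, d)\<in>?T. h (8 * int j + 1) * g (int d))"
  proof (rule sum.reindex_bij_witness[of _
      "\<lambda>(j, x, d). (x, int d, int (w (n - j) div d))"
      "\<lambda>(x, d, e). (nat (x\<^sup>2 div 8), x, nat d)"], goal_cases)
    case (1 a)
    then show ?case by (cases a) (auto dest!: rep)
  next
    case (2 a)
    then show ?case by (cases a) (auto dest!: rep)
  next
    case (3 b)
    then show ?case by auto
  next
    case (4 b)
    obtain j x d where b: "b = (j, x, d)" by (cases b)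
    have *: "j \<le> n" "x\<^sup>2 = 8 * int j + 1" "d dvd w (n - j)" using 4 b by auto
    have "odd (x\<^sup>2)" using * by simp
    hence "odd x" by simp
    moreover have "c * int d * int (w (n - j) div d) = c * int (w (n - j))"
      using *(3) by (simp flip: of_nat_mult)
    moreover have "d > 0" using dvd_pos_nat[OF w_pos *(3)] .
    moreover have "w (n - j) div d > 0"
      using dvd_imp_le[OF *(3) w_pos] dvd_pos_nat[OF w_pos *(3)] by (simp add: div_greater_zero_iff)
    ultimately show ?case using * b w[of "n - j"] by (simp add: qreps_def of_nat_diff)
  next
    case (5 a)
    then show ?case by (cases a) (auto dest!: rep)
  qed
  also have "\<dots> = (\<Sum>j\<le>n. \<Sum>(x, d)\<in>?X j \<times> {d. d dvd w (n - j)}. h (8 * int j + 1) * g (int d))"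
    by (rule sum.Sigma[symmetric]) (simp_all add: finite_sqrt_set fin)
  also have "\<dots> = (\<Sum>j\<le>n. \<Sum>x\<in>?X j. \<Sum>d | d dvd w (n - j). h (8 * int j + 1) * g (int d))"
    by (simp only: sum.cartesian_product)
  also have "\<dots> = (\<Sum>j\<le>n. 2 * (tri_ind j * h (8 * int j + 1) * (\<Sum>d | d dvd w (n - j). g (int d))))"
    by (intro sum.cong) (simp_all add: sum_distrib_left[symmetric] card_sqrt_set mult.assoc)
  finally show ?thesis by (simp add: sum_distrib_left)
qed

text \<open>Comparing coefficients in \<open>\<psi> * (\<psi> ^ k)' = k * \<psi>' * \<psi> ^ k\<close> gives this recurrence.\<close>

definition psi_power_rec :: "nat \<Rightarrow> (nat \<Rightarrow> int) \<Rightarrow> bool" where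
  "psi_power_rec k f \<longleftrightarrow>
     (\<forall>n. (\<Sum>j\<le>n. tri_ind j * (int n - (int k + 1) * int j) * f (n - j)) = 0)"

text \<open>The summand for j = 0 is \<open>int n * f n\<close>, and the others only involve smaller
  indices, so the recurrence determines \<open>f n\<close> for n > 0.\<close>

lemma psi_power_rec_unique:
  assumes f: "psi_power_rec k f" and g: "psi_power_rec k g" and "f 0 = g 0"
  shows "f n = g n"
proof (induction n rule: less_induct)
  case (less n)
  show ?case
  proof (cases n)
    case (Suc m)
    let ?s = "\<lambda>f. \<Sum>j\<in>{1..n}. tri_ind j * (int n - (int k + 1) * int j) * f (n - j)"
    have split: "{..n} = insert 0 {1..n}" by auto
    have ti: "tri_ind 0 = 1" by (auto simp: tri_ind_def intro: range_eqI[of _ _ 0])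
    have "int n * f n + ?s f = 0" "int n * g n + ?s g = 0"
      using f g by (auto simp: psi_power_rec_def split ti dest!: spec[of _ n])
    moreover have "?s f = ?s g"
      using less by (intro sum.cong) auto
    ultimately have "int n * f n = int n * g n" by linarith
    thus ?thesis using Suc by simp
  qed (use assms in simp)
qed

section \<open>The coefficients of the fourth and sixth powers of \<open>psi\<close>\<close>

definition psi :: "int fps" where
  "psi = Abs_fps tri_ind"

lemma psi_power_rec_psi: "psi_power_rec k (fps_nth (psi ^ k))"
  unfolding psi_power_rec_def
proof
  fix n
  let ?F = "psi ^ k"
  have D: "psi * fps_deriv ?F = of_nat k * fps_deriv psi * ?F"
  proof (cases k)
    case (Suc m)
    have "fps_deriv ?F = of_nat k * fps_deriv psi * psi ^ m"
      using fps_deriv_power'[of psi k] Suc by (simp only: diff_Suc_1)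
    thus ?thesis by (simp only: Suc power_Suc mult_ac)
  qed simp
  \<comment> \<open>Multiplying by \<open>fps_X\<close> makes the derivative act on coefficient
    \<open>m\<close> as multiplication by \<open>m\<close>, without an index shift.\<close>
  have "psi * (fps_X * fps_deriv ?F) - of_nat k * ((fps_X * fps_deriv psi) * ?F) = 0"
    using D by (simp add: algebra_simps)
  moreover have nthX: "(fps_X * fps_deriv f) $ m = int m * f $ m" for f :: "int fps" and m
    by (cases m) (simp_all add: fps_X_mult_nth)
  have "(psi * (fps_X * fps_deriv ?F)) $ n = (\<Sum>j\<le>n. tri_ind j * (int (n - j) * ?F $ (n - j)))"
    unfolding fps_mult_nth[of psi] nthX atLeast0AtMost by (simp add: psi_def)
  moreover have "(fps_X * fps_deriv psi * ?F) $ n = (\<Sum>j\<le>n. int j * tri_ind j * ?F $ (n - j))"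
    unfolding fps_mult_nth[of "fps_X * fps_deriv psi"] nthX atLeast0AtMost by (simp add: psi_def)
  ultimately have "0 = (\<Sum>j\<le>n. tri_ind j * (int (n - j) * ?F $ (n - j))) -
      int k * (\<Sum>j\<le>n. int j * tri_ind j * ?F $ (n - j))"
    by (metis fps_mult_of_nat_nth(1) fps_sub_nth fps_zero_nth)
  also have "\<dots> = (\<Sum>j\<le>n. tri_ind j * (int n - (int k + 1) * int j) * ?F $ (n - j))"
    unfolding sum_distrib_left sum_subtractf[symmetric]
    by (intro sum.cong) (auto simp: of_nat_diff algebra_simps)
  finally show "(\<Sum>j\<le>n. tri_ind j * (int n - (int k + 1) * int j) * ?F $ (n - j)) = 0"
    by simp
qed

text \<open>Here c = r = 4 and 4(2k + 1) = 8k + 4. The weight 8n + 5 - 5(8j + 1) equals 8(n - 5j),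
  which is the factor of the recurrence.\<close>

lemma psi_power_rec_sigma1: "psi_power_rec 4 (\<lambda>n. int (sigma1 (2 * n + 1)))"
  unfolding psi_power_rec_def
proof
  fix n
  have *: "(\<Sum>(x, d, e)\<in>qreps 4 (8 * int n + 1 + 4). (8 * int n + 5 - 5 * x\<^sup>2) * d) =
    2 * (\<Sum>j\<le>n. tri_ind j * (8 * int n + 5 - 5 * (8 * int j + 1)) * (\<Sum>d | d dvd 2 * (n - j) + 1. int d))"
    by (rule sum_qreps_eq[where h = "\<lambda>y. 8 * int n + 5 - 5 * y" and g = "\<lambda>d. d"]) auto
  have "(8 * int n + 5) mod 8 = 5" by presburger
  from sum_qreps_4_eq_0[OF this] * have
    "0 = 2 * (\<Sum>j\<le>n. tri_ind j * (8 * int n + 5 - 5 * (8 * int j + 1)) * (\<Sum>d | d dvd 2 * (n - j) + 1. int d))"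
    by (simp add: add.assoc)
  also have "\<dots> = (\<Sum>j\<le>n. 16 * (tri_ind j * (int n - (int 4 + 1) * int j) * int (sigma1 (2 * (n - j) + 1))))"
    unfolding sum_distrib_left[of 2] by (intro sum.cong) (simp_all add: sigma1_def algebra_simps)
  finally show "(\<Sum>j\<le>n. tri_ind j * (int n - (int 4 + 1) * int j) * int (sigma1 (2 * (n - j) + 1))) = 0"
    by (simp add: sum_distrib_left[symmetric])
qed

lemma chi4_int_of_nat [simp]: "chi4_int (int n) = chi4 n"
proof -
  have "int n mod 4 = 1 \<longleftrightarrow> n mod 4 = 1" "int n mod 4 = 3 \<longleftrightarrow> n mod 4 = 3" by presburger+
  thus ?thesis unfolding chi4_int_def chi4_def by simp
qed

text \<open>Here c = 2 and r = 6 in \<open>sum_qreps_eq\<close>, with 2(4k + 3) = 8k + 6; the weight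
  is 8(n - 7j). The scalar \<open>c\<close> of this statement serves to adjust the initial
  value.\<close>

lemma psi_power_rec_sigma2_chi: "psi_power_rec 6 (\<lambda>n. c * sigma2_chi (4 * n + 3))"
  unfolding psi_power_rec_def
proof
  fix n
  have *: "(\<Sum>(x, d, e)\<in>qreps 2 (8 * int n + 1 + 6). (8 * int n + 7 - 7 * x\<^sup>2) * (chi4_int d * d\<^sup>2)) =
    2 * (\<Sum>j\<le>n. tri_ind j * (8 * int n + 7 - 7 * (8 * int j + 1)) *
           (\<Sum>d | d dvd 4 * (n - j) + 3. chi4_int (int d) * (int d)\<^sup>2))"
    by (rule sum_qreps_eq[where h = "\<lambda>y. 8 * int n + 7 - 7 * y" and g = "\<lambda>d. chi4_int d * d\<^sup>2"]) auto
  have "(8 * int n + 7) mod 8 = 7" by presburger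
  from sum_qreps_2_eq_0[OF this] * have
    "0 = 2 * (\<Sum>j\<le>n. tri_ind j * (8 * int n + 7 - 7 * (8 * int j + 1)) *
           (\<Sum>d | d dvd 4 * (n - j) + 3. chi4_int (int d) * (int d)\<^sup>2))"
    by (simp add: add.assoc)
  also have "\<dots> = (\<Sum>j\<le>n. 16 * (tri_ind j * (int n - (int 6 + 1) * int j) * sigma2_chi (4 * (n - j) + 3)))"
    unfolding sum_distrib_left[of 2] by (intro sum.cong) (simp_all add: sigma2_chi_def algebra_simps)
  finally have "(\<Sum>j\<le>n. tri_ind j * (int n - (int 6 + 1) * int j) * sigma2_chi (4 * (n - j) + 3)) = 0"
    by (simp add: sum_distrib_left[symmetric])
  moreover have "(\<Sum>j\<le>n. tri_ind j * (int n - (int 6 + 1) * int j) * (c * sigma2_chi (4 * (n - j) + 3))) =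
     c * (\<Sum>j\<le>n. tri_ind j * (int n - (int 6 + 1) * int j) * sigma2_chi (4 * (n - j) + 3))"
    by (simp add: sum_distrib_left mult_ac)
  ultimately show "(\<Sum>j\<le>n. tri_ind j * (int n - (int 6 + 1) * int j) * (c * sigma2_chi (4 * (n - j) + 3))) = 0"
    by simp
qed

lemma psi_nth_0 [simp]: "psi $ 0 = 1"
  by (auto simp: psi_def tri_ind_def intro: range_eqI[of _ _ 0])

lemma psi_power_4_nth: "(psi ^ 4) $ n = int (sigma1 (2 * n + 1))"
proof (rule psi_power_rec_unique[OF psi_power_rec_psi psi_power_rec_sigma1])
  show "(psi ^ 4) $ 0 = int (sigma1 (2 * 0 + 1))"
    by (simp add: sigma1_def fps_nth_power_0)
qed

text \<open>The recurrence fixes the sequence up to its value at 0, where the divisor sum is 1 - 9 =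
  -8; this is the source of the factor 8 and of the sign.\<close>

lemma psi_power_6_nth: "8 * (psi ^ 6) $ n = - sigma2_chi (4 * n + 3)"
proof -
  have "prime (3::nat)" by simp
  hence "{d. d dvd (3::nat)} = {1, 3}" by (auto simp: prime_nat_iff)
  hence "sigma2_chi 3 = -8" by (simp add: sigma2_chi_def chi4_def)
  moreover have "psi_power_rec 6 (\<lambda>n. 8 * (psi ^ 6) $ n)"
    using psi_power_rec_psi[of 6] unfolding psi_power_rec_def
    by (simp add: mult.left_commute[of _ 8] sum_distrib_left[symmetric])
  ultimately have "8 * (psi ^ 6) $ n = - 1 * sigma2_chi (4 * n + 3)"
    using psi_power_rec_unique[OF _ psi_power_rec_sigma2_chi[of "-1"],
        of "\<lambda>n. 8 * (psi ^ 6) $ n" n]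
    by (simp add: fps_nth_power_0)
  thus ?thesis by simp
qed

section \<open>Gauss' product for \<open>\<psi>\<close>\<close>

text \<open>\<open>Od\<close> and \<open>Ev\<close> are the finite q-Pochhammer products of (q; q^2)
  and (q^2; q^2) with \<open>n\<close> factors each. Indexing by the exponents lets them be compared
  directly with products over sets of parts.\<close>

definition Od :: "'a::comm_ring_1 \<Rightarrow> nat \<Rightarrow> 'a" where
  "Od q n = (\<Prod>k | k \<in> {1..2 * n} \<and> odd k. 1 - q ^ k)"

definition Ev :: "'a::comm_ring_1 \<Rightarrow> nat \<Rightarrow> 'a" where
  "Ev q n = (\<Prod>k | k \<in> {1..2 * n} \<and> even k. 1 - q ^ k)"

definition psi_sum :: "'a::comm_ring_1 \<Rightarrow> nat \<Rightarrow> 'a" where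
  "psi_sum q n = (\<Sum>k\<le>n. q ^ tri k)"

lemma Od_0 [simp]: "Od q 0 = 1" and Ev_0 [simp]: "Ev q 0 = 1"
  by (simp_all add: Od_def Ev_def)

lemma Od_Suc: "Od q (Suc n) = Od q n * (1 - q ^ (2 * n + 1))"
proof -
  have "{k \<in> {1..2 * Suc n}. odd k} = insert (2 * n + 1) {k \<in> {1..2 * n}. odd k}"
    by (auto simp: le_Suc_eq)
  thus ?thesis by (simp add: Od_def mult_ac)
qed

lemma Ev_Suc: "Ev q (Suc n) = Ev q n * (1 - q ^ (2 * n + 2))"
proof -
  have "{k \<in> {1..2 * Suc n}. even k} = insert (2 * n + 2) {k \<in> {1..2 * n}. even k}"
    by (auto simp: le_Suc_eq)
  thus ?thesis by (simp add: Ev_def mult_ac)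
qed

text \<open>A division-free form of the quotient of \<open>Ev q n\<close> by
  \<open>Ev q s\<close>.\<close>

definition Ev_tail :: "'a::comm_ring_1 \<Rightarrow> nat \<Rightarrow> nat \<Rightarrow> 'a" where
  "Ev_tail q s n = (\<Prod>r\<in>{s<..n}. 1 - q ^ (2 * r))"

lemma Ev_tail_same [simp]: "Ev_tail q n n = 1"
  by (simp add: Ev_tail_def)

lemma Ev_tail_Suc: "s \<le> n \<Longrightarrow> Ev_tail q s (Suc n) = Ev_tail q s n * (1 - q ^ (2 * n + 2))"
  by (simp add: Ev_tail_def prod.nat_ivl_Suc' mult_ac flip: atLeastSucAtMost_greaterThanAtMost)

lemma Ev_tail_0: "Ev_tail q 0 n = Ev q n"
  by (induction n) (simp_all add: Ev_tail_Suc Ev_Suc del: power_Suc)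

lemma Ev_tail_rec: "s < n \<Longrightarrow> Ev_tail q s n = (1 - q ^ (2 * Suc s)) * Ev_tail q (Suc s) n"
  by (simp add: Ev_tail_def prod.atLeast_Suc_atMost flip: atLeastSucAtMost_greaterThanAtMost)

text \<open>
  Shanks' finite form of Gauss' identity, with denominators cleared; the summands of
  the step from \<open>n\<close> to \<open>Suc n\<close> telescope.
\<close>

lemma shanks_identity:
  "Od q n * psi_sum q (2 * n) = (\<Sum>s\<le>n. Ev_tail q s n * Od q s * q ^ (s * (2 * n + 1)))"
proof (induction n)
  case 0
  show ?case by (simp add: psi_sum_def)
next
  case (Suc n)
  let ?t = "\<lambda>n s. Ev_tail q s n * Od q s * q ^ (s * (2 * n + 1))"
  let ?v = "\<lambda>s. Ev_tail q s n * Od q (Suc s) * q ^ (Suc s * (2 * n + 1))"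
  have step: "?t (Suc n) s - (1 - q ^ (2 * n + 1)) * ?t n s =
     ?v s - Ev_tail q s n * (1 - q ^ (2 * s)) * Od q s * q ^ (s * (2 * n + 1))" if "s \<le> n" for s
  proof -
    have e1: "q ^ (s * (2 * Suc n + 1)) = q ^ (s * (2 * n + 1)) * q ^ (2 * s)"
      unfolding power_add[symmetric] by (rule arg_cong[where f = "power q"]) (simp add: algebra_simps)
    have e2: "q ^ (Suc s * (2 * n + 1)) = q ^ (s * (2 * n + 1)) * q ^ (2 * n + 1)"
      unfolding power_add[symmetric] by (rule arg_cong[where f = "power q"]) (simp add: algebra_simps)
    have e3: "q ^ (2 * n + 2) = q ^ (2 * n + 1) * q" "q ^ (2 * s + 1) = q ^ (2 * s) * q"
      by simp_all
    show ?thesis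
      unfolding Ev_tail_Suc[OF that] e1 e2 e3 Od_Suc
      by (simp only: algebra_simps mult_1 mult_1_right)
  qed
  \<comment> \<open>The subtracted part at \<open>Suc m\<close> is \<open>?v m\<close> by
    \<open>Ev_tail_rec\<close>; at s = 0 it vanishes because of the factor
    \<open>1 - q ^ 0\<close>.\<close>
  have tele: "(\<Sum>s\<le>m. ?v s - Ev_tail q s n * (1 - q ^ (2 * s)) * Od q s * q ^ (s * (2 * n + 1))) = ?v m"
    if "m \<le> n" for m
    using that
  proof (induction m)
    case (Suc m)
    hence "?v m = (1 - q ^ (2 * Suc m)) * Ev_tail q (Suc m) n * Od q (Suc m) * q ^ (Suc m * (2 * n + 1))"
      using Ev_tail_rec[of m n q] by simp
    thus ?case using Suc by (simp add: mult_ac)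
  qed simp
  have "(\<Sum>s\<le>Suc n. ?t (Suc n) s) = (1 - q ^ (2 * n + 1)) * (\<Sum>s\<le>n. ?t n s) +
      (\<Sum>s\<le>n. ?t (Suc n) s - (1 - q ^ (2 * n + 1)) * ?t n s) + ?t (Suc n) (Suc n)"
    by (simp only: sum_subtractf sum_distrib_left[symmetric] sum.atMost_Suc) simp
  also have "(\<Sum>s\<le>n. ?t (Suc n) s - (1 - q ^ (2 * n + 1)) * ?t n s) = ?v n"
    by (rule trans[OF sum.cong[OF refl step] tele[OF order_refl]]) simp
  also have "(\<Sum>s\<le>n. ?t n s) = Od q n * psi_sum q (2 * n)"
    using Suc.IH by simp
  finally have "(\<Sum>s\<le>Suc n. ?t (Suc n) s) =
      Od q (Suc n) * (psi_sum q (2 * n) + q ^ (Suc n * (2 * n + 1)) + q ^ (Suc n * (2 * Suc n + 1)))"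
    by (simp only: Ev_tail_same Od_Suc algebra_simps mult_1 mult_1_right)
  \<comment> \<open>The end of the telescope and the new top summand supply exactly the two
    triangular exponents with indices 2n + 1 and 2n + 2.\<close>
  also have "psi_sum q (2 * n) + q ^ (Suc n * (2 * n + 1)) + q ^ (Suc n * (2 * Suc n + 1)) =
      psi_sum q (2 * Suc n)"
  proof -
    have "tri (Suc (2 * n)) = Suc n * (2 * n + 1)" "tri (Suc (Suc (2 * n))) = Suc n * (2 * Suc n + 1)"
      using two_tri[of "Suc (2 * n)"] two_tri[of "Suc (Suc (2 * n))"] by (simp_all add: algebra_simps)
    thus ?thesis by (simp add: psi_sum_def)
  qed
  finally show ?case by simp
qed

text \<open>In \<open>shanks_identity\<close> the summand s = 0 is \<open>Ev q n\<close>, and every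
  other one contains \<open>q ^ (2 * n + 1)\<close>. Divisibility takes the place of a limit of
  infinite products.\<close>

lemma gauss_psi_dvd: "q ^ (2 * n + 1) dvd Od q n * psi_sum q (2 * n) - Ev q n"
proof -
  have "(\<Sum>s\<le>n. Ev_tail q s n * Od q s * q ^ (s * (2 * n + 1))) =
        Ev q n + (\<Sum>s\<in>{1..n}. Ev_tail q s n * Od q s * q ^ (s * (2 * n + 1)))"
    by (simp add: atMost_atLeast0 sum.atLeast_Suc_atMost Ev_tail_0)
  moreover have "q ^ (2 * n + 1) dvd (\<Sum>s\<in>{1..n}. Ev_tail q s n * Od q s * q ^ (s * (2 * n + 1)))"
  proof (intro dvd_sum dvd_mult le_imp_power_dvd)
    show "2 * n + 1 \<le> s * (2 * n + 1)" if "s \<in> {1..n}" for s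
      using that by (cases s) auto
  qed
  ultimately show ?thesis unfolding shanks_identity by simp
qed

section \<open>Power series modulo a prime and modulo powers of \<open>fps_X\<close>\<close>

lemma freshmans_dream_sum_dvd:
  fixes f :: "'a \<Rightarrow> 'b::comm_ring_1"
  assumes p: "prime p" and "finite A"
  shows "of_nat p dvd (\<Sum>i\<in>A. f i) ^ p - (\<Sum>i\<in>A. f i ^ p)"
  using \<open>finite A\<close>
proof induction
  case empty
  show ?case using p by (simp add: prime_gt_0_nat power_0_left)
next
  case (insert a A)
  \<comment> \<open>Outside the two end terms the binomial coefficients are divisible by
    \<open>p\<close>. Divisibility is used because the ring, later \<open>int fps\<close>, need not
    have characteristic \<open>p\<close>.\<close>
  have "of_nat p dvd (x + y) ^ p - (x ^ p + y ^ p)" for x y :: 'b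
  proof -
    have split: "{..p} = insert 0 (insert p {0<..<p})" by auto
    have "(x + y) ^ p = x ^ p + y ^ p + (\<Sum>k\<in>{0<..<p}. of_nat (p choose k) * x ^ k * y ^ (p - k))"
      using prime_gt_0_nat[OF p] unfolding binomial_ring split by (simp add: algebra_simps)
    moreover have "of_nat p dvd (of_nat (p choose k) :: 'b)" if "k \<in> {0<..<p}" for k
    proof -
      have "p dvd (p choose k)" using that p by (intro dvd_choose_prime) auto
      thus ?thesis by (elim dvdE) simp
    qed
    hence "of_nat p dvd (\<Sum>k\<in>{0<..<p}. of_nat (p choose k) * x ^ k * y ^ (p - k))"
      by (intro dvd_sum dvd_mult2)
    ultimately show ?thesis by simp
  qed
  from dvd_add[OF this[of "f a" "sum f A"] insert.IH] insert.hyps show ?case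
    by (simp add: algebra_simps)
qed

lemma fps_X_power_dvd_iff:
  fixes f :: "'a::comm_ring_1 fps"
  shows "fps_X ^ n dvd f \<longleftrightarrow> (\<forall>i<n. f $ i = 0)"
proof
  assume "\<forall>i<n. f $ i = 0"
  hence "f = fps_X ^ n * fps_shift n f"
    by (intro fps_ext) (simp add: fps_X_power_mult_nth)
  thus "fps_X ^ n dvd f" by (rule dvdI)
next
  assume "fps_X ^ n dvd f"
  then obtain g where "f = fps_X ^ n * g" ..
  thus "\<forall>i<n. f $ i = 0" by (simp add: fps_X_power_mult_nth)
qed

text \<open>As \<open>u\<close> has constant term 1, \<open>f $ i\<close> is
  \<open>(u * f) $ i\<close> minus a combination of earlier coefficients of \<open>f\<close>. The
  case m = 0 cancels \<open>u\<close> modulo a power of \<open>fps_X\<close>.\<close>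

lemma fps_dvd_nth_cancel:
  fixes u f :: "'a::comm_ring_1 fps"
  assumes u: "u $ 0 = 1" and dvd: "\<And>i. i < n \<Longrightarrow> m dvd (u * f) $ i" and "i < n"
  shows "m dvd f $ i"
  using \<open>i < n\<close>
proof (induction i rule: less_induct)
  case (less i)
  have "(u * f) $ i = f $ i + (\<Sum>j\<in>{1..i}. u $ j * f $ (i - j))"
    by (simp add: fps_mult_nth sum.atLeast_Suc_atMost u)
  moreover have "m dvd (\<Sum>j\<in>{1..i}. u $ j * f $ (i - j))"
    using less by (intro dvd_sum dvd_mult) auto
  ultimately show ?case
    using dvd[OF less.prems] by (simp add: dvd_add_left_iff)
qed

text \<open>Since \<open>k \<le> tri k\<close>, each triangular number up to \<open>m\<close>
  already occurs among the indices up to \<open>n\<close>, and only once by strict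
  monotonicity.\<close>

lemma psi_sum_psi_dvd:
  assumes "m \<le> n"
  shows "fps_X ^ Suc m dvd psi - psi_sum fps_X n"
  unfolding fps_X_power_dvd_iff
proof (intro allI impI)
  fix i assume i: "i < Suc m"
  have "psi_sum fps_X n $ i = (\<Sum>k\<le>n. if i = tri k then 1 else 0 :: int)"
    by (simp add: psi_sum_def fps_sum_nth fps_X_power_iff)
  also have "\<dots> = tri_ind i"
  proof (cases "i \<in> range tri")
    case True
    then obtain k where k: "i = tri k" by auto
    have "k \<le> n" using tri_ge[of k] i k assms by simp
    have "(\<Sum>k\<le>n. if i = tri k then 1 else 0 :: int) = (\<Sum>k'\<le>n. if k' = k then 1 else 0)"
      using strict_mono_eq[OF strict_mono_tri] k by (intro sum.cong) auto
    thus ?thesis using True \<open>k \<le> n\<close> by (simp add: tri_ind_def)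
  next
    case False
    hence "i \<noteq> tri k" for k by auto
    thus ?thesis using False by (simp add: tri_ind_def)
  qed
  finally show "(psi - psi_sum fps_X n) $ i = 0" by (simp add: psi_def)
qed

section \<open>The generating function of \<open>pod\<close>\<close>

text \<open>An arbitrary set \<open>A\<close> of admissible parts allows induction by adding one
  part size at a time.\<close>

definition pod_parts :: "nat set \<Rightarrow> nat \<Rightarrow> nat multiset set" where
  "pod_parts A n = {P. sum_mset P = n \<and> set_mset P \<subseteq> A \<and> (\<forall>k. odd k \<longrightarrow> count P k \<le> 1)}"

lemma finite_pod_parts:
  assumes "0 \<notin> A"
  shows "finite (pod_parts A n)"
proof (rule finite_subset)
  \<comment> \<open>Only 0 is divisible by 0, so \<open>l = 0\<close> excludes no positive
    part.\<close>
  show "pod_parts A n \<subseteq> pod_partitions 0 n"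
    using assms by (auto simp: pod_parts_def pod_partitions_def intro!: Nat.gr0I)
qed (rule finite_pod_partitions)

lemma pod_parts_empty: "pod_parts {} n = (if n = 0 then {{#}} else {})"
  by (auto simp: pod_parts_def)

text \<open>Partitions containing \<open>k\<close> correspond to the rest after removing one copy;
  \<open>k\<close> may occur again in the rest exactly when it is even.\<close>

lemma card_pod_parts_insert:
  assumes k: "k \<notin> A" "k > 0" "0 \<notin> A"
  shows "card (pod_parts (insert k A) n) = card (pod_parts A n) +
    (if k \<le> n then card (pod_parts (if even k then insert k A else A) (n - k)) else 0)"
proof -
  let ?B = "pod_parts (if even k then insert k A else A) (n - k)"
  let ?I = "{P \<in> pod_parts (insert k A) n. k \<in># P}"
  have "pod_parts (insert k A) n = pod_parts A n \<union> ?I" "pod_parts A n \<inter> ?I = {}"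
    using k by (auto simp: pod_parts_def)
  moreover have "finite (pod_parts (insert k A) n)" using k by (intro finite_pod_parts) auto
  ultimately have "card (pod_parts (insert k A) n) = card (pod_parts A n) + card ?I"
    by (metis card_Un_disjoint finite_Un)
  also have "card ?I = (if k \<le> n then card ?B else 0)"
  proof (cases "k \<le> n")
    case True
    have "bij_betw (add_mset k) ?B ?I"
    proof (rule bij_betwI[where g = "\<lambda>P. P - {#k#}"])
      show "add_mset k \<in> ?B \<rightarrow> ?I"
      proof
        fix P assume P: "P \<in> ?B"
        have "count P k = 0" if "odd k"
          using P that k by (auto simp: pod_parts_def not_in_iff[symmetric])
        thus "add_mset k P \<in> ?I"
          using P True by (auto simp: pod_parts_def split: if_splits)
      qed
      show "(\<lambda>P. P - {#k#}) \<in> ?I \<rightarrow> ?B"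
      proof
        fix P assume P: "P \<in> ?I"
        then obtain Q where Q: "P = add_mset k Q" by (auto dest: multi_member_split)
        have *: "sum_mset Q = n - k" "set_mset Q \<subseteq> insert k A"
            "\<And>j. odd j \<Longrightarrow> count (add_mset k Q) j \<le> 1"
          using P Q by (auto simp: pod_parts_def)
        have "count Q j \<le> 1" if "odd j" for j
          using *(3)[OF that] by (simp split: if_splits)
        moreover have "k \<notin># Q" if "odd k"
          using *(3)[OF that] by (simp add: not_in_iff)
        ultimately have "Q \<in> ?B" using * by (auto simp: pod_parts_def)
        thus "P - {#k#} \<in> ?B" by (simp add: Q)
      qed
    qed auto
    thus ?thesis using True by (simp add: bij_betw_same_card)
  next
    case False
    have "k \<le> n" if P: "P \<in> ?I" for P
    proof -
      obtain Q where "P = add_mset k Q" using P multi_member_split[of k P] by blast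
      thus ?thesis using P by (simp add: pod_parts_def)
    qed
    hence "?I = {}" using False by blast
    thus ?thesis using False by (simp only: card.empty if_False)
  qed
  finally show ?thesis .
qed

text \<open>
  The sign amounts to replacing \<open>q\<close> by \<open>-q\<close>, so that all factors of the generating
  function have the form \<open>1 - q ^ k\<close>.
\<close>

definition pod_fps :: "nat set \<Rightarrow> int fps" where
  "pod_fps A = Abs_fps (\<lambda>n. (-1) ^ n * int (card (pod_parts A n)))"

lemma pod_fps_empty: "pod_fps {} = 1"
  by (intro fps_ext) (auto simp: pod_fps_def pod_parts_empty)

lemma pod_fps_insert:
  assumes k: "k \<notin> A" "k > 0" "0 \<notin> A"
  shows "pod_fps (insert k A) = pod_fps A + (-1) ^ k * fps_X ^ k * pod_fps (if even k then insert k A else A)"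
proof (intro fps_ext)
  fix n
  have "((-1) ^ k * fps_X ^ k * f) $ n = (-1) ^ k * (if n < k then 0 else f $ (n - k))" for f :: "int fps"
    by (cases "even k") (simp_all add: fps_X_power_mult_nth)
  then show "pod_fps (insert k A) $ n =
      (pod_fps A + (-1) ^ k * fps_X ^ k * pod_fps (if even k then insert k A else A)) $ n"
    unfolding fps_add_nth by (simp add: pod_fps_def card_pod_parts_insert[OF k, of n] minus_one_power_iff)
qed

text \<open>Write F' for the series after adding \<open>k\<close>. For even \<open>k\<close> it
  satisfies F' = F + X^k F', so a factor 1 - X^k moves to the left; for odd \<open>k\<close> the
  sign gives F' = (1 - X^k) F.\<close>

lemma pod_fps_mult_prod:
  assumes "finite A" "0 \<notin> A"
  shows "pod_fps A * (\<Prod>k | k \<in> A \<and> even k. 1 - fps_X ^ k) = (\<Prod>k | k \<in> A \<and> odd k. 1 - fps_X ^ k)"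
  using assms
proof (induction A rule: finite_induct)
  case empty
  show ?case by (simp add: pod_fps_empty)
next
  case (insert k A)
  hence k: "k \<notin> A" "k > 0" "0 \<notin> A" by auto
  note rec = pod_fps_insert[OF k]
  show ?case
  proof (cases "even k")
    case True
    have sets: "{j. j \<in> insert k A \<and> even j} = insert k {j \<in> A. even j}"
      "{j. j \<in> insert k A \<and> odd j} = {j \<in> A. odd j}" using True by auto
    have sgn: "(-1) ^ k = (1 :: int fps)" using True by simp
    have "f * (1 - x) = g" if "f = g + x * f" for f g x :: "int fps"
      using that by algebra
    from this[OF rec[unfolded if_P[OF True] sgn mult_1_left]]
    have "pod_fps (insert k A) * (1 - fps_X ^ k) = pod_fps A" .
    thus ?thesis unfolding sets using insert by (simp add: mult.assoc[symmetric])
  next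
    case False
    have sets: "{j. j \<in> insert k A \<and> even j} = {j \<in> A. even j}"
      "{j. j \<in> insert k A \<and> odd j} = insert k {j \<in> A. odd j}" using False by auto
    have "pod_fps (insert k A) = (1 - fps_X ^ k) * pod_fps A"
      using rec False by (simp add: algebra_simps)
    thus ?thesis unfolding sets using insert by (simp add: mult.assoc)
  qed
qed

text \<open>A part of a partition of \<open>n\<close> is at most \<open>n\<close>, so bounding the
  parts by \<open>N\<close> loses nothing.\<close>

lemma pod_eq_pod_fps_nth:
  assumes "n \<le> N"
  shows "pod_fps {k \<in> {1..N}. \<not> l dvd k} $ n = (-1) ^ n * int (pod l n)"
proof -
  have le: "k \<le> N" if P: "k \<in># P" "sum_mset P = n" for k and P :: "nat multiset"
  proof -
    obtain Q where "P = add_mset k Q" using multi_member_split[OF P(1)] by blast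
    thus ?thesis using P assms by simp
  qed
  have "set_mset P \<subseteq> {k \<in> {1..N}. \<not> l dvd k} \<longleftrightarrow> (\<forall>k. k \<in># P \<longrightarrow> k > 0 \<and> \<not> l dvd k)"
    if "sum_mset P = n" for P
    using le[OF _ that] by (auto simp: Suc_le_eq)
  hence "pod_parts {k \<in> {1..N}. \<not> l dvd k} n = pod_partitions l n"
    unfolding pod_parts_def pod_partitions_def by (intro Collect_cong conj_cong refl)
  thus ?thesis by (simp add: pod_fps_def pod_def)
qed

section \<open>The congruence between \<open>pod\<close> and a power of \<open>psi\<close>\<close>

lemma prod_multiples_split:
  fixes q :: "'a::comm_ring_1"
  assumes "odd l"
  shows "(\<Prod>k | k \<in> {1..2 * (l * n)} \<and> P (even k). 1 - q ^ k) =
         (\<Prod>k | k \<in> {k \<in> {1..2 * (l * n)}. \<not> l dvd k} \<and> P (even k). 1 - q ^ k) *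
         (\<Prod>k | k \<in> {1..2 * n} \<and> P (even k). 1 - (q ^ l) ^ k)"
proof -
  have l: "l > 0" using assms by (intro Nat.gr0I) auto
  \<comment> \<open>Multiplication by the odd \<open>l\<close> preserves parity, so it matches the
    exponents up to 2n with the multiples of \<open>l\<close> up to 2ln for either choice of
    \<open>P\<close>.\<close>
  have "(\<Prod>k | k \<in> {1..2 * n} \<and> P (even k). 1 - (q ^ l) ^ k) =
        (\<Prod>k | k \<in> {k \<in> {1..2 * (l * n)}. l dvd k} \<and> P (even k). 1 - q ^ k)"
  proof (rule prod.reindex_bij_witness[of _ "\<lambda>k. k div l" "\<lambda>k. l * k"], goal_cases)
    case (2 k)
    thus ?case using l assms by simp
  next
    case (4 k)
    then obtain m where "k = l * m" by (auto elim: dvdE)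
    thus ?case using 4 l assms by (simp add: Suc_le_eq)
  qed (use l in \<open>auto simp: power_mult\<close>)
  moreover have "{k. k \<in> {1..2 * (l * n)} \<and> P (even k)} =
      {k. k \<in> {k \<in> {1..2 * (l * n)}. \<not> l dvd k} \<and> P (even k)} \<union>
      {k. k \<in> {k \<in> {1..2 * (l * n)}. l dvd k} \<and> P (even k)}" by auto
  ultimately show ?thesis
    by (simp only:) (rule prod.union_disjoint, auto)
qed

lemma Od_nth_0: "Od (fps_X ^ l) n $ 0 = (1 :: int)" if "l > 0"
  using that by (induction n) (simp_all add: Od_Suc fps_nth_power_0 flip: power_mult)

text \<open>With \<open>F\<close> the signed series, F \<psi>(q) = \<psi>(q^l) up to order 2n, and
  \<psi>(q^l) is \<psi>(q)^l modulo the prime \<open>l\<close>; one factor \<psi>(q) is then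
  cancelled. The ideal generated by \<open>I\<close> keeps coefficient \<open>n\<close>
  intact.\<close>

lemma pod_cong_psi_power:
  assumes l: "prime l" "odd l"
  shows "[int (pod l n) = (-1) ^ n * (psi ^ (l - 1)) $ n] (mod int l)"
proof -
  let ?A = "{k \<in> {1..2 * (l * n)}. \<not> l dvd k}" and ?X = "fps_X :: int fps"
  have l0: "l > 0" using l by (simp add: prime_gt_0_nat)
  define F where "F = pod_fps ?A"
  define I where "I = ?X ^ Suc (2 * n)"
  have ln: "n \<le> l * n" using l0 by simp
  \<comment> \<open>The factors belonging to multiples of \<open>l\<close>, absent from
    \<open>F\<close>, are restored on both sides; they form the products in
    \<open>?X ^ l\<close>.\<close>
  have "F * Ev ?X (l * n) * Od (?X ^ l) n = Od ?X (l * n) * Ev (?X ^ l) n"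
  proof -
    have "F * (\<Prod>k | k \<in> ?A \<and> even k. 1 - ?X ^ k) = (\<Prod>k | k \<in> ?A \<and> odd k. 1 - ?X ^ k)"
      unfolding F_def by (rule pod_fps_mult_prod) auto
    moreover have "F * (a * b) * c = (d * c) * b" if "F * a = d" for a b c d
      unfolding that[symmetric] by (simp only: mult_ac)
    ultimately show ?thesis
      unfolding Ev_def Od_def prod_multiples_split[OF l(2), where P = "\<lambda>x. x"]
        prod_multiples_split[OF l(2), where P = "\<lambda>x. \<not> x"]
      by blast
  qed
  moreover have "I dvd Od ?X (l * n) * psi_sum ?X (2 * (l * n)) - Ev ?X (l * n)"
    by (rule dvd_trans[OF _ gauss_psi_dvd]) (use ln in \<open>auto simp: I_def simp del: power_Suc intro!: le_imp_power_dvd\<close>)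
  moreover have "I dvd Od (?X ^ l) n * psi_sum (?X ^ l) (2 * n) - Ev (?X ^ l) n"
  proof (rule dvd_trans[OF _ gauss_psi_dvd])
    have "Suc (2 * n) \<le> l * (2 * n + 1)" using l0 by (cases l) auto
    thus "I dvd (?X ^ l) ^ (2 * n + 1)"
      unfolding I_def power_mult[symmetric] by (rule le_imp_power_dvd)
  qed
  ultimately have "I dvd Od ?X (l * n) * Od (?X ^ l) n *
      (F * psi_sum ?X (2 * (l * n)) - psi_sum (?X ^ l) (2 * n))"
  proof -
    let ?O = "Od ?X (l * n)" and ?O' = "Od (?X ^ l) n" and ?E = "Ev ?X (l * n)" and ?E' = "Ev (?X ^ l) n"
    let ?p = "psi_sum ?X (2 * (l * n))" and ?p' = "psi_sum (?X ^ l) (2 * n)"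
    assume *: "F * ?E * ?O' = ?O * ?E'" "I dvd ?O * ?p - ?E" "I dvd ?O' * ?p' - ?E'"
    have "I dvd F * ?O' * (?O * ?p - ?E) - ?O * (?O' * ?p' - ?E')"
      by (rule dvd_diff[OF dvd_mult[OF *(2)] dvd_mult[OF *(3)]])
    also have "F * ?O' * (?O * ?p - ?E) - ?O * (?O' * ?p' - ?E') = ?O * ?O' * (F * ?p - ?p') - (F * ?E * ?O' - ?O * ?E')"
      by (simp only: algebra_simps)
    finally show ?thesis using * by simp
  qed
  \<comment> \<open>The two \<open>Od\<close> factors have constant term 1 and cancel modulo
    \<open>I\<close>.\<close>
  hence I1: "I dvd F * psi_sum ?X (2 * (l * n)) - psi_sum (?X ^ l) (2 * n)"
    unfolding I_def fps_X_power_dvd_iff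
    using fps_dvd_nth_cancel[of "Od ?X (l * n) * Od (?X ^ l) n" "Suc (2 * n)" 0
      "F * psi_sum ?X (2 * (l * n)) - psi_sum (?X ^ l) (2 * n)"]
      Od_nth_0[OF l0] Od_nth_0[of 1 "l * n"] by simp
  have I2: "I dvd F * (psi - psi_sum ?X (2 * (l * n)))"
    unfolding I_def by (intro dvd_mult psi_sum_psi_dvd) (use ln in simp)
  have I3: "I dvd psi ^ l - psi_sum ?X (2 * n) ^ l"
  proof -
    have "psi - psi_sum ?X (2 * n) dvd psi ^ l - psi_sum ?X (2 * n) ^ l"
      by (simp add: power_diff_sumr2)
    thus ?thesis unfolding I_def using psi_sum_psi_dvd[of "2 * n" "2 * n"] by (blast intro: dvd_trans)
  qed
  have "I dvd (F * psi_sum ?X (2 * (l * n)) - psi_sum (?X ^ l) (2 * n)) + F * (psi - psi_sum ?X (2 * (l * n)))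
      - (psi ^ l - psi_sum ?X (2 * n) ^ l)"
    by (rule dvd_diff[OF dvd_add[OF I1 I2] I3])
  also have "\<dots> = F * psi - psi ^ l + (psi_sum ?X (2 * n) ^ l - psi_sum (?X ^ l) (2 * n))"
    by (simp add: algebra_simps)
  finally have J: "I dvd F * psi - psi ^ l + (psi_sum ?X (2 * n) ^ l - psi_sum (?X ^ l) (2 * n))" .
  have K: "of_nat l dvd psi_sum ?X (2 * n) ^ l - psi_sum (?X ^ l) (2 * n)"
    using freshmans_dream_sum_dvd[OF l(1), of "{..2 * n}" "\<lambda>k. ?X ^ tri k"]
    by (simp add: psi_sum_def mult.commute flip: power_mult)
  \<comment> \<open>Modulo \<open>I\<close> the product differs from zero only by the freshman's
    dream error \<open>K\<close>, all of whose coefficients are multiples of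
    \<open>l\<close>.\<close>
  have "int l dvd (psi * (F - psi ^ (l - 1))) $ i" if "i < Suc (2 * n)" for i
  proof -
    have "psi ^ l = psi * psi ^ (l - 1)"
      using l0 by (simp add: power_eq_if)
    hence "psi * (F - psi ^ (l - 1)) = F * psi - psi ^ l" by (simp add: algebra_simps)
    moreover have "(F * psi - psi ^ l) $ i + (psi_sum ?X (2 * n) ^ l - psi_sum (?X ^ l) (2 * n)) $ i = 0"
      using J that unfolding I_def fps_X_power_dvd_iff fps_add_nth by blast
    moreover have "int l dvd (psi_sum ?X (2 * n) ^ l - psi_sum (?X ^ l) (2 * n)) $ i"
    proof -
      obtain g where g: "psi_sum ?X (2 * n) ^ l - psi_sum (?X ^ l) (2 * n) = of_nat l * g"
        using K ..
      show ?thesis unfolding g by (simp add: fps_mult_of_nat_nth)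
    qed
    ultimately show ?thesis by (metis dvd_0_right dvd_add_left_iff)
  qed
  hence "int l dvd (F - psi ^ (l - 1)) $ n"
    by (rule fps_dvd_nth_cancel[OF psi_nth_0, where n = "Suc (2 * n)"]) simp_all
  hence "int l dvd F $ n - (psi ^ (l - 1)) $ n" by simp
  hence "[F $ n = (psi ^ (l - 1)) $ n] (mod int l)" by (simp add: cong_iff_dvd_diff)
  moreover have "F $ n = (-1) ^ n * int (pod l n)"
    unfolding F_def by (rule pod_eq_pod_fps_nth) (use ln in simp)
  \<comment> \<open>A second factor \<open>(-1) ^ n\<close> undoes the substitution of -q for
    q.\<close>
  ultimately have "[(-1) ^ n * ((-1) ^ n * int (pod l n)) = (-1) ^ n * (psi ^ (l - 1)) $ n] (mod int l)"
    by (intro cong_scalar_left) simp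
  thus ?thesis by (simp flip: mult.assoc power_add mult_2)
qed

theorem theorem3:
  fixes n :: nat
  assumes "n > 0"
  shows "[int (pod 5 n) = (-1) ^ n * int (sigma1 (2 * n + 1))] (mod 5) \<and>
         rat_cong (of_nat (pod 7 n))
                  ((-1) ^ (n + 1) * (1 / 8) * of_int (sigma2_chi (4 * n + 3))) 7"
proof
  show "[int (pod 5 n) = (-1) ^ n * int (sigma1 (2 * n + 1))] (mod 5)"
    using pod_cong_psi_power[of 5 n] by (simp add: psi_power_4_nth)
next
  have "[int (pod 7 n) = (-1) ^ n * (psi ^ 6) $ n] (mod 7)"
    using pod_cong_psi_power[of 7 n] by simp
  then obtain a where a: "int (pod 7 n) - (-1) ^ n * (psi ^ 6) $ n = 7 * a"
    by (auto simp: cong_iff_dvd_diff)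
  \<comment> \<open>The divisor sum is exactly -8 times an integer coefficient, so the fraction 1/8
    disappears and the denominator 1 is a valid witness.\<close>
  have "of_int (sigma2_chi (4 * n + 3)) = - 8 * (of_int ((psi ^ 6) $ n) :: rat)"
    using arg_cong[OF psi_power_6_nth[of n], of "of_int :: int \<Rightarrow> rat"] by simp
  hence "(of_nat (pod 7 n) :: rat) - (-1) ^ (n + 1) * (1 / 8) * of_int (sigma2_chi (4 * n + 3)) =
      of_int (int (pod 7 n) - (-1) ^ n * (psi ^ 6) $ n)"
    by simp
  also have "\<dots> = of_int 7 * (of_int a / of_int 1)"
    unfolding a by simp
  finally show "rat_cong (of_nat (pod 7 n))
                  ((-1) ^ (n + 1) * (1 / 8) * of_int (sigma2_chi (4 * n + 3))) 7"
    unfolding rat_cong_def by (intro exI[of _ a] exI[of _ 1]) auto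
qed

end
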